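(* For any graph $G$ of order $n$ and any integer $n'\ge 2$, $$\gamma_{\rm sp}(G\circ N_{n'})\le nn'-2\rho(L(G)).$$
   Context: All graphs are finite, simple and undirected; the order of a graph is its number of vertices. $N_{m}$ denotes the empty (edgeless) graph of order $m$. For a vertex $v$ of $G$, $N(v)$ is the set of vertices adjacent to $v$, $N[v]=N(v)\cup\{v\}$, and for $D\subseteq V(G)$, $\overline{D}=V(G)\setminus D$. A set $D\subseteq V(G)$ is a super dominating set of $G$ if for every $u\in\overline{D}$ there exists $v\in D$ such that $N(v)\cap\overline{D}=\{u\}$. The super domination number $\gamma_{\rm sp}(G)$ is the minimum cardinality of a super dominating set of $G$. The lexicographic product $G\circ H$ has vertex set $V(G)\times V(H)$, and $(g,h)$ is adjacent to $(g',h')$ if and only if $gg'\in E(G)$, or $g=g'$ and $hh'\in E(H)$. A set $S$ of vertices of a graph is a $2$-packing if $N[u]\cap N[v]=\emptyset$ for every pair of distinct vertices $u,v\in S$; the $2$-packing number $\rho(G)$ is the maximum cardinality of a $2$-packing of $G$. The line graph $L(G)$ has the edges of $G$ as its vertices, two of them being adjacent in $L(G)$ if and only if they are adjacent edges of $G$ (i.e. distinct edges sharing an endpoint). If $G$ has no edges then $\rho(L(G))=0$. *)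

theory Defs
  imports "Graph_Theory.Pair_Digraph"
begin

text \<open>
  A finite simple undirected graph is a \<^locale>\<open>pair_graph\<close>: a finite, loop-free, symmetric
  digraph without parallel arcs, in which the edge \<open>uv\<close> is represented by the two arcs
  \<open>(u, v)\<close> and \<open>(v, u)\<close>. The order of \<open>G\<close> is \<open>card (pverts G)\<close>.
\<close>

definition nbhd :: "'a pair_pre_digraph \<Rightarrow> 'a \<Rightarrow> 'a set" where
  "nbhd G v = {u \<in> pverts G. (v, u) \<in> parcs G}"

definition closed_nbhd :: "'a pair_pre_digraph \<Rightarrow> 'a \<Rightarrow> 'a set" where
  "closed_nbhd G v = nbhd G v \<union> {v}"

definition super_dominating :: "'a pair_pre_digraph \<Rightarrow> 'a set \<Rightarrow> bool" where
  "super_dominating G D \<longleftrightarrow> D \<subseteq> pverts G \<and>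
     (\<forall>u \<in> pverts G - D. \<exists>v \<in> D. nbhd G v \<inter> (pverts G - D) = {u})"

text \<open>
  For a finite graph, the \<^const>\<open>Min\<close> and \<^const>\<open>Max\<close> below are taken over finite nonempty sets;
  see the lemmas at the end.
\<close>

definition super_domination_number :: "'a pair_pre_digraph \<Rightarrow> nat" where
  "super_domination_number G = Min {card D | D. super_dominating G D}"

definition two_packing :: "'a pair_pre_digraph \<Rightarrow> 'a set \<Rightarrow> bool" where
  "two_packing G S \<longleftrightarrow> S \<subseteq> pverts G \<and>
     (\<forall>u \<in> S. \<forall>v \<in> S. u \<noteq> v \<longrightarrow> closed_nbhd G u \<inter> closed_nbhd G v = {})"

definition two_packing_number :: "'a pair_pre_digraph \<Rightarrow> nat" where
  "two_packing_number G = Max {card S | S. two_packing G S}"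

definition empty_graph :: "nat \<Rightarrow> nat pair_pre_digraph" where
  "empty_graph m = \<lparr>pverts = {..<m}, parcs = {}\<rparr>"

definition lex_product ::
    "'a pair_pre_digraph \<Rightarrow> 'b pair_pre_digraph \<Rightarrow> ('a \<times> 'b) pair_pre_digraph" where
  "lex_product G H = \<lparr>pverts = pverts G \<times> pverts H,
     parcs = {((g, h), (g', h')) | g h g' h'.
       g \<in> pverts G \<and> g' \<in> pverts G \<and> h \<in> pverts H \<and> h' \<in> pverts H \<and>
       ((g, g') \<in> parcs G \<or> g = g' \<and> (h, h') \<in> parcs H)}\<rparr>"

text \<open>Undirected edges are two-element sets, so that both arcs of an edge yield the same vertex
  of the line graph.\<close>

definition edges :: "'a pair_pre_digraph \<Rightarrow> 'a set set" where
  "edges G = {{u, v} | u v. (u, v) \<in> parcs G}"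

definition line_graph :: "'a pair_pre_digraph \<Rightarrow> 'a set pair_pre_digraph" where
  "line_graph G = \<lparr>pverts = edges G,
     parcs = {(e, f). e \<in> edges G \<and> f \<in> edges G \<and> e \<noteq> f \<and> e \<inter> f \<noteq> {}}\<rparr>"

lemma pair_graphI:
  assumes "finite (pverts G)" "parcs G \<subseteq> pverts G \<times> pverts G" "sym (parcs G)" "irrefl (parcs G)"
  shows "pair_graph G"
proof
  show "symmetric (with_proj G)"
    using assms(3) by (simp add: symmetric_def)
  show "finite (parcs G)"
    using assms(1,2) by (meson finite_SigmaI finite_subset)
qed (use assms in \<open>auto simp: irrefl_def\<close>)

lemma pair_graph_simple:
  assumes "pair_graph G"
  shows "finite (pverts G)" "parcs G \<subseteq> pverts G \<times> pverts G" "sym (parcs G)" "irrefl (parcs G)"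
proof -
  interpret pair_graph G by fact
  show "finite (pverts G)" by simp
  show "parcs G \<subseteq> pverts G \<times> pverts G" by (auto dest: in_arcsD1 in_arcsD2)
  show "sym (parcs G)" using pair_sym_arcs by (simp add: symmetric_def)
  show "irrefl (parcs G)" using pair_no_loops by (fastforce simp: irrefl_def)
qed

lemma pair_graph_empty_graph: "pair_graph (empty_graph m)"
  by (rule pair_graphI) (auto simp: empty_graph_def sym_def irrefl_def)

lemma pair_graph_lex_product:
  assumes "pair_graph G" "pair_graph H"
  shows "pair_graph (lex_product G H)"
  using pair_graph_simple[OF assms(1)] pair_graph_simple[OF assms(2)]
  by (intro pair_graphI) (auto simp: lex_product_def sym_def irrefl_def)

lemma pair_graph_line_graph:
  assumes "pair_graph G"
  shows "pair_graph (line_graph G)"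
proof (rule pair_graphI)
  have "edges G \<subseteq> Pow (pverts G)"
    using pair_graph_simple(2)[OF assms] by (auto simp: edges_def)
  then show "finite (pverts (line_graph G))"
    using pair_graph_simple(1)[OF assms] by (simp add: line_graph_def finite_subset)
qed (auto simp: line_graph_def sym_def irrefl_def)

lemma super_domination_number_set:
  assumes "finite (pverts G)"
  shows "finite {card D | D. super_dominating G D}" "{card D | D. super_dominating G D} \<noteq> {}"
proof -
  have "{card D | D. super_dominating G D} \<subseteq> card ` Pow (pverts G)"
    by (auto simp: super_dominating_def)
  then show "finite {card D | D. super_dominating G D}"
    using assms by (meson finite_Pow_iff finite_imageI finite_subset)
  have "super_dominating G (pverts G)"
    by (simp add: super_dominating_def)
  then show "{card D | D. super_dominating G D} \<noteq> {}"
    by blast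
qed

lemma two_packing_number_set:
  assumes "finite (pverts G)"
  shows "finite {card S | S. two_packing G S}" "{card S | S. two_packing G S} \<noteq> {}"
proof -
  have "{card S | S. two_packing G S} \<subseteq> card ` Pow (pverts G)"
    by (auto simp: two_packing_def)
  then show "finite {card S | S. two_packing G S}"
    using assms by (meson finite_Pow_iff finite_imageI finite_subset)
  have "two_packing G {}"
    by (simp add: two_packing_def)
  then show "{card S | S. two_packing G S} \<noteq> {}"
    by blast
qed

lemma two_packing_number_line_graph_edgeless:
  assumes "parcs G = {}"
  shows "two_packing_number (line_graph G) = 0"
proof -
  have "{card S | S. two_packing (line_graph G) S} = {0}"
    using assms by (auto simp: two_packing_def line_graph_def edges_def)
  then show ?thesis by (simp add: two_packing_number_def)
qed

end

theory Submission
  imports Defs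
begin

text \<open>
  A \<open>2\<close>-packing of the line graph of \<open>G\<close> is an induced matching of \<open>G\<close>: two of its edges neither
  share an endpoint nor are joined by a third edge. Let \<open>X\<close> be the set of endpoints of such a
  matching \<open>S\<close>, so that \<open>card X = 2 * card S\<close>. Each \<open>x \<in> X\<close> has a partner \<open>y\<close>, and \<open>x\<close> is the only
  neighbour of \<open>y\<close> in \<open>X\<close>. In the lexicographic product with an edgeless graph of order at least
  two, remove the single layer \<open>X \<times> {0}\<close>. What remains is super dominating: \<open>(x, 0)\<close> is the only
  removed neighbour of \<open>(y, 1)\<close>, and the second layer is there to keep this vertex although
  \<open>(y, 0)\<close> itself is removed. A largest \<open>2\<close>-packing gives the bound.
\<close>

lemma super_domination_number_le:
  assumes "finite (pverts G)" "super_dominating G D"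
  shows "super_domination_number G \<le> card D"
  unfolding super_domination_number_def
  using super_domination_number_set(1)[OF assms(1)] assms(2) by (auto intro!: Min_le)

lemma two_packing_number_attained:
  assumes "finite (pverts G)"
  obtains S where "two_packing G S" "card S = two_packing_number G"
proof -
  have "two_packing_number G \<in> {card S | S. two_packing G S}"
    unfolding two_packing_number_def using two_packing_number_set[OF assms] by (rule Max_in)
  then show thesis
    using that by auto
qed

text \<open>The joining edge would lie in the closed neighbourhoods of both \<open>e\<close> and \<open>f\<close> in the line
  graph; this includes the cases where it equals one of them.\<close>

lemma two_packing_line_graph_no_joining_edge:
  assumes "two_packing (line_graph G) S" "e \<in> S" "f \<in> S"
    and "(a, b) \<in> parcs G" "a \<in> e" "b \<in> f"
  shows "e = f"
proof (rule ccontr)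
  assume "e \<noteq> f"
  have S: "S \<subseteq> edges G"
    using assms(1) by (simp add: two_packing_def line_graph_def)
  have "{a, b} \<in> edges G"
    using assms(4) by (auto simp: edges_def)
  then have "{a, b} \<in> closed_nbhd (line_graph G) e" "{a, b} \<in> closed_nbhd (line_graph G) f"
    using S assms by (auto simp: closed_nbhd_def nbhd_def line_graph_def)
  then show False
    using assms(1-3) \<open>e \<noteq> f\<close> by (auto simp: two_packing_def)
qed

lemma two_packing_line_graph_disjoint:
  assumes "two_packing (line_graph G) S" "e \<in> S" "f \<in> S" "e \<noteq> f"
  shows "e \<inter> f = {}"
proof (rule ccontr)
  assume "e \<inter> f \<noteq> {}"
  then have "f \<in> closed_nbhd (line_graph G) e" "f \<in> closed_nbhd (line_graph G) f"
    using assms by (auto simp: closed_nbhd_def nbhd_def line_graph_def two_packing_def)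
  then show False
    using assms by (auto simp: two_packing_def)
qed

lemma card_Union_two_packing_line_graph:
  assumes "pair_graph G" "two_packing (line_graph G) S"
  shows "card (\<Union>S) = 2 * card S"
proof -
  have S: "S \<subseteq> edges G"
    using assms(2) by (simp add: two_packing_def line_graph_def)
  have two: "card e = 2" if "e \<in> S" for e
  proof -
    obtain u v where "e = {u, v}" "(u, v) \<in> parcs G"
      using \<open>e \<in> S\<close> S by (auto simp: edges_def)
    then show ?thesis
      using pair_graph_simple(4)[OF assms(1)] by (auto simp: irrefl_def card_insert_if)
  qed
  have "card (\<Union>S) = (\<Sum>e\<in>S. card e)"
  proof (rule card_Union_disjoint)
    show "pairwise disjnt S"
      using two_packing_line_graph_disjoint[OF assms(2)] by (auto simp: pairwise_def disjnt_def)
    show "finite e" if "e \<in> S" for e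
      using two[OF that] by (simp add: card_ge_0_finite)
  qed
  then show ?thesis
    using two by simp
qed

text \<open>The partner of a covered vertex is the other endpoint of its edge in \<open>S\<close>: any other
  covered neighbour of the partner would lie on an edge of \<open>S\<close> joined to this one.\<close>

lemma two_packing_line_graph_partner:
  assumes "pair_graph G" "two_packing (line_graph G) S" "x \<in> \<Union>S"
  obtains y where "y \<in> pverts G" "nbhd G y \<inter> \<Union>S = {x}"
proof -
  note G = pair_graph_simple[OF assms(1)]
  obtain e where e: "e \<in> S" "x \<in> e"
    using assms(3) by auto
  have "e \<in> edges G"
    using e assms(2) by (auto simp: two_packing_def line_graph_def)
  then obtain y where y: "e = {x, y}" "(y, x) \<in> parcs G"
    using e(2) G(3) by (auto simp: edges_def sym_def)
  have "z = x" if z: "z \<in> nbhd G y" "z \<in> f" "f \<in> S" for z f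
  proof -
    have "(y, z) \<in> parcs G"
      using z(1) by (simp add: nbhd_def)
    then have "e = f"
      using two_packing_line_graph_no_joining_edge[OF assms(2) e(1) z(3)] y(1) z(2) by blast
    then show ?thesis
      using \<open>(y, z) \<in> parcs G\<close> z(2) y(1) G(4) by (auto simp: irrefl_def)
  qed
  moreover have "x \<in> nbhd G y" "y \<in> pverts G"
    using y(2) G(2) by (auto simp: nbhd_def)
  ultimately show thesis
    using that[of y] assms(3) by blast
qed

lemma nbhd_lex_product_empty_graph:
  assumes "g \<in> pverts G" "i < m"
  shows "nbhd (lex_product G (empty_graph m)) (g, i) = nbhd G g \<times> {..<m}"
  using assms by (auto simp: nbhd_def lex_product_def empty_graph_def)

text \<open>The private neighbours of the vertices of \<open>X\<close> may belong to \<open>X\<close> themselves; their copies in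
  the layer \<open>1\<close> have the same neighbours and are not removed.\<close>

lemma super_dominating_lex_product_minus_layer:
  assumes "m \<ge> 2" "X \<subseteq> pverts G"
    and private_nbr: "\<And>x. x \<in> X \<Longrightarrow> \<exists>y \<in> pverts G. nbhd G y \<inter> X = {x}"
  shows "super_dominating (lex_product G (empty_graph m)) (pverts G \<times> {..<m} - X \<times> {0})"
    (is "super_dominating ?L ?D")
proof -
  have V: "pverts ?L = pverts G \<times> {..<m}"
    by (simp add: lex_product_def empty_graph_def)
  then have C: "pverts ?L - ?D = X \<times> {0}"
    using assms(1,2) by auto
  have "\<exists>v \<in> ?D. nbhd ?L v \<inter> X \<times> {0} = {u}" if u: "u \<in> X \<times> {0}" for u
  proof -
    obtain x where x: "u = (x, 0)" "x \<in> X"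
      using u by auto
    obtain y where y: "y \<in> pverts G" "nbhd G y \<inter> X = {x}"
      using private_nbr[OF x(2)] by auto
    have "(y, 1) \<in> ?D"
      using y(1) assms(1) by auto
    moreover have "nbhd ?L (y, 1) = nbhd G y \<times> {..<m}"
      using y(1) assms(1) by (intro nbhd_lex_product_empty_graph) simp_all
    then have "nbhd ?L (y, 1) \<inter> X \<times> {0} = (nbhd G y \<inter> X) \<times> {0}"
      using assms(1) by (simp add: Times_Int_Times)
    then have "nbhd ?L (y, 1) \<inter> X \<times> {0} = {u}"
      by (simp add: x(1) y(2))
    ultimately show ?thesis
      by blast
  qed
  moreover have "?D \<subseteq> pverts ?L"
    using V by auto
  ultimately show ?thesis
    unfolding super_dominating_def C by blast
qed

theorem theorem13:
  fixes G :: "'a pair_pre_digraph" and n n' :: nat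
  assumes "pair_graph G" and "card (pverts G) = n" and "n' \<ge> 2"
  shows "int (super_domination_number (lex_product G (empty_graph n')))
    \<le> int n * int n' - 2 * int (two_packing_number (line_graph G))"
proof -
  let ?L = "lex_product G (empty_graph n')"
  note G = pair_graph_simple[OF assms(1)]
  obtain S where S: "two_packing (line_graph G) S"
      "card S = two_packing_number (line_graph G)"
    using two_packing_number_attained pair_graph_simple(1)[OF pair_graph_line_graph[OF assms(1)]]
    by blast
  define X where "X = \<Union>S"
  have sub: "X \<subseteq> pverts G"
    using S(1) G(2) by (auto simp: X_def two_packing_def line_graph_def edges_def)
  have layer: "X \<times> {0} \<subseteq> pverts G \<times> {..<n'}"
    using sub assms(3) by auto
  have "super_dominating ?L (pverts G \<times> {..<n'} - X \<times> {0})"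
  proof (rule super_dominating_lex_product_minus_layer[OF assms(3) sub])
    show "\<exists>y \<in> pverts G. nbhd G y \<inter> X = {x}" if "x \<in> X" for x
      using two_packing_line_graph_partner[OF assms(1) S(1)] that unfolding X_def by metis
  qed
  then have "super_domination_number ?L \<le> card (pverts G \<times> {..<n'} - X \<times> {0})"
    using pair_graph_simple(1)[OF pair_graph_lex_product[OF assms(1) pair_graph_empty_graph]]
    by (rule super_domination_number_le[rotated])
  also have "\<dots> = n * n' - 2 * card S"
    using layer finite_subset[OF sub G(1)] assms(2)
      card_Union_two_packing_line_graph[OF assms(1) S(1)]
    by (simp add: card_Diff_subset card_cartesian_product X_def)
  finally have "super_domination_number ?L \<le> n * n' - 2 * card S" .
  moreover have "2 * card S \<le> n * n'"
    using card_mono[OF _ layer] G(1) assms(2)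
      card_Union_two_packing_line_graph[OF assms(1) S(1)]
    by (simp add: card_cartesian_product X_def)
  ultimately show ?thesis
    using S(2) by (simp flip: of_nat_mult)
qed

end
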